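(* Suppose that $F:\mathbb{R}^n\to\mathbb{R}^m$ is continuously differentiable, that there is $\kappa_{\mathrm{lg}}>0$ with $\|\nabla F^{(i)}(x)-\nabla F^{(i)}(y)\|\le\kappa_{\mathrm{lg}}\|x-y\|$ for all $x,y\in\mathbb{R}^n$ and $i=1,\dots,m$, and that $\nabla F^{(1)}(x),\dots,\nabla F^{(m)}(x)$ are $s$-sparse for all $x\in\mathbb{R}^n$. Let $\kappa_{\mathrm{bv}}>0$, and in the algorithm let $\sigma_k=\|d_{k-1}\|$ and $\xi_k=\sqrt{p}\,\kappa_{\mathrm{lg}}\kappa_{\mathrm{bv}}^2\sigma_k/2$ ($k\ge1$). If $T_k$ happens, i.e. $A(v_k)$ is an RIP matrix and $\|v_k^j\|\le\kappa_{\mathrm{bv}}$ for all $j=1,\dots,p$, then the Jacobian model $J_{m_k}$ is $\kappa_{\mathrm{ej}}$-first-order accurate, i.e. $$\|J_{m_k}-J(x_k)\|\le\frac{\kappa_{\mathrm{ej}}}{\theta_k},\qquad\text{where}\quad \kappa_{\mathrm{ej}}=\frac{\sqrt{mp}\,c_1\gamma_2\kappa_{\mathrm{lg}}\kappa_{\mathrm{bv}}^2}{2}.$$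
   Context: Norms: $\|\cdot\|$ is the Euclidean norm of vectors and the spectral norm of matrices, $\|\cdot\|_1$ is the $\ell_1$ norm. $F=(F^{(1)},\dots,F^{(m)}):\mathbb{R}^n\to\mathbb{R}^m$ has Jacobian $J(x)\in\mathbb{R}^{m\times n}$. A vector is $s$-sparse if it has at most $s$ nonzero entries ($s\ge1$ a fixed integer). $p<n$ is a fixed positive integer. RIP: the $q$-RIP constant $\delta_q$ of a matrix $A$ is the smallest number such that $(1-\delta_q)\|x\|^2\le\|Ax\|^2\le(1+\delta_q)\|x\|^2$ for all $q$-sparse $x$. $A$ is called an RIP matrix if its $2s$-RIP constant satisfies $\delta_{2s}<0.4931$. The constant $c_1$ is the constant of the following known recovery theorem (Mo and Li, 2011), which may be used: let $y=A\hat x+z$, where $\hat x$ is $s$-sparse and $\|z\|\le\xi$. If the $2s$-RIP constant of $A$ satisfies $\delta_{2s}<0.4931$, then the solution $x^*$ of $\min_{x\in\mathbb{R}^n}\|x\|_1$ subject to $\|Ax-y\|\le\xi$ satisfies $\|x^*-\hat x\|\le c_1\xi$, where $c_1$ is a constant depending only on $\delta_{2s}$. Here it is applied with $A=A(v_k)$. Algorithm. Parameters: $0<\eta_0<1$, $0<\eta_1<\eta_2$, $0<\gamma_1<1<\gamma_2$, $x_0\in\mathbb{R}^n$, $\theta_0\ge\theta_{\min}>0$, $\varepsilon_0>0$. For $k=0,1,2,\dots$: (1) Generate random vectors $v_k=\{v_k^1,\dots,v_k^p\}\subset\mathbb{R}^n$. Let $A(v_k)\in\mathbb{R}^{p\times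 n}$ be the matrix with rows $(v_k^1)^T,\dots,(v_k^p)^T$ and, for $i=1,\dots,m$, let $y_k^{(i)}\in\mathbb{R}^p$ have entries $F^{(i)}(x_k+\sigma_kv_k^j)-F^{(i)}(x_k)$, $j=1,\dots,p$. With $\sigma_k>0$, $\xi_k>0$, let $g_k^{(i)}$ be a solution of $\min_{g\in\mathbb{R}^n}\|g\|_1$ subject to $\|A(v_k)g-\sigma_k^{-1}y_k^{(i)}\|\le\xi_k$, and let $J_{m_k}\in\mathbb{R}^{m\times n}$ be the matrix with rows $(g_k^{(1)})^T,\dots,(g_k^{(m)})^T$. (2) With $F_k=F(x_k)$, if $\|J_{m_k}^TF_k\|\le\varepsilon_0$, stop. Otherwise let $d_k$ solve $(J_{m_k}^TJ_{m_k}+\lambda_kI)d=-J_{m_k}^TF_k$, where $\lambda_k=\theta_k\|J_{m_k}^TF_k\|$. (3) Let $\rho_k=\dfrac{\|F_k\|^2-\|F(x_k+d_k)\|^2}{\|F_k\|^2-\|F_k+J_{m_k}d_k\|^2}$. (4) Set $x_{k+1}=x_k+d_k$ if $\rho_k\ge\eta_0$, and $x_{k+1}=x_k$ otherwise. (5) If $\rho_k<\eta_0$ set $\theta_{k+1}=\gamma_2\theta_k$. Otherwise set $\theta_{k+1}=\gamma_2\theta_k$ if $\|J_{m_k}^TF_k\|<\eta_1/\theta_k$; $\theta_{k+1}=\theta_k$ if $\|J_{m_k}^TF_k\|\in[\eta_1/\theta_k,\eta_2/\theta_k]$; $\theta_{k+1}=\max\{\gamma_1\theta_k,\theta_{\min}\}$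 if $\|J_{m_k}^TF_k\|>\eta_2/\theta_k$. The initial $\sigma_0>0$ is arbitrary. The statement concerns the $k$-th iteration ($k\ge1$) of a realization of the algorithm that reaches it. *)

theory Defs
  imports "HOL-Analysis.Analysis"
begin

definition l1_norm :: "real ^ 'n \<Rightarrow> real" where
  "l1_norm x = (\<Sum>i\<in>UNIV. \<bar>x $ i\<bar>)"

definition is_sparse :: "nat \<Rightarrow> real ^ 'n \<Rightarrow> bool" where
  "is_sparse q x \<longleftrightarrow> card {i. x $ i \<noteq> 0} \<le> q"

definition spectral_norm :: "real ^ 'n ^ 'm \<Rightarrow> real" where
  "spectral_norm A = onorm (\<lambda>x. A *v x)"

definition grad :: "(real ^ 'n \<Rightarrow> real) \<Rightarrow> real ^ 'n \<Rightarrow> real ^ 'n" where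
  "grad f x = (THE D. GDERIV f x :> D)"

definition continuously_differentiable :: "(real ^ 'n \<Rightarrow> real ^ 'm) \<Rightarrow> bool" where
  "continuously_differentiable F \<longleftrightarrow>
     (\<forall>x. F differentiable (at x)) \<and> continuous_on UNIV (\<lambda>x. jacobian F (at x))"

definition rip_bounds :: "nat \<Rightarrow> real ^ 'n ^ 'p \<Rightarrow> real \<Rightarrow> bool" where
  "rip_bounds q A \<delta> \<longleftrightarrow>
     (\<forall>x. is_sparse q x \<longrightarrow>
        (1 - \<delta>) * (norm x)\<^sup>2 \<le> (norm (A *v x))\<^sup>2 \<and>
        (norm (A *v x))\<^sup>2 \<le> (1 + \<delta>) * (norm x)\<^sup>2)"

text \<open>The least constant exists whenever \<open>q > 0\<close>; see \<open>rip_const_least\<close> below.\<close>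

definition rip_const :: "nat \<Rightarrow> real ^ 'n ^ 'p \<Rightarrow> real" where
  "rip_const q A = (LEAST \<delta>. rip_bounds q A \<delta>)"

definition rip_matrix :: "nat \<Rightarrow> real ^ 'n ^ 'p \<Rightarrow> bool" where
  "rip_matrix s A \<longleftrightarrow> rip_const (2 * s) A < 0.4931"

definition l1_solution :: "real ^ 'n ^ 'p \<Rightarrow> real ^ 'p \<Rightarrow> real \<Rightarrow> real ^ 'n \<Rightarrow> bool" where
  "l1_solution A b \<xi> g \<longleftrightarrow> is_arg_min l1_norm (\<lambda>h. norm (A *v h - b) \<le> \<xi>) g"

text \<open>
  A constant of the sparse recovery theorem of Mo and Li. It may depend only on the
  restricted isometry constant, so it is a function of that real number. The type argument
  fixes the shape of the matrices; a constant valid for all shapes and all sparsity levels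
  satisfies the predicate in particular.
\<close>

definition recovery_const ::
  "(real ^ 'n ^ 'p) itself \<Rightarrow> nat \<Rightarrow> (real \<Rightarrow> real) \<Rightarrow> bool" where
  "recovery_const T s c \<longleftrightarrow>
     (\<forall>(A :: real ^ 'n ^ 'p) xhat z \<xi> xstar.
        rip_const (2 * s) A < 0.4931 \<and> is_sparse s xhat \<and> norm z \<le> \<xi> \<and>
        l1_solution A (A *v xhat + z) \<xi> xstar \<longrightarrow>
        norm (xstar - xhat) \<le> c (rip_const (2 * s) A) * \<xi>)"

definition sample_matrix :: "('p::finite \<Rightarrow> real ^ 'n) \<Rightarrow> real ^ 'n ^ 'p" where
  "sample_matrix v = (\<chi> j. v j)"

definition sample_diff ::
  "(real ^ 'n \<Rightarrow> real) \<Rightarrow> real ^ 'n \<Rightarrow> real \<Rightarrow> ('p::finite \<Rightarrow> real ^ 'n) \<Rightarrow> real ^ 'p" where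
  "sample_diff f x \<sigma> v = (\<chi> j. f (x + \<sigma> *\<^sub>R v j) - f x)"

definition model_step ::
  "(real ^ 'n \<Rightarrow> real ^ 'm) \<Rightarrow> real ^ 'n \<Rightarrow> real \<Rightarrow> real \<Rightarrow> ('p::finite \<Rightarrow> real ^ 'n)
    \<Rightarrow> real ^ 'n ^ 'm \<Rightarrow> bool" where
  "model_step F x \<sigma> \<xi> v J \<longleftrightarrow>
     0 < \<sigma> \<and> 0 < \<xi> \<and>
     (\<forall>i. l1_solution (sample_matrix v)
            (inverse \<sigma> *\<^sub>R sample_diff (\<lambda>u. F u $ i) x \<sigma> v) \<xi> (row i J))"

definition model_gradient ::
  "(real ^ 'n \<Rightarrow> real ^ 'm) \<Rightarrow> real ^ 'n \<Rightarrow> real ^ 'n ^ 'm \<Rightarrow> real ^ 'n" where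
  "model_gradient F x J = transpose J *v F x"

definition trial_step ::
  "(real ^ 'n \<Rightarrow> real ^ 'm) \<Rightarrow> real ^ 'n \<Rightarrow> real ^ 'n ^ 'm \<Rightarrow> real \<Rightarrow> real ^ 'n \<Rightarrow> bool" where
  "trial_step F x J \<theta> d \<longleftrightarrow>
     (transpose J ** J + (\<theta> * norm (model_gradient F x J)) *\<^sub>R mat 1) *v d
       = - model_gradient F x J"

definition reduction_ratio ::
  "(real ^ 'n \<Rightarrow> real ^ 'm) \<Rightarrow> real ^ 'n \<Rightarrow> real ^ 'n ^ 'm \<Rightarrow> real ^ 'n \<Rightarrow> real" where
  "reduction_ratio F x J d =
     ((norm (F x))\<^sup>2 - (norm (F (x + d)))\<^sup>2) /
     ((norm (F x))\<^sup>2 - (norm (F x + J *v d))\<^sup>2)"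

text \<open>Below, \<open>r\<close> stands for the norm of the model gradient and \<open>\<rho>\<close> for the reduction ratio.\<close>

definition next_theta ::
  "real \<Rightarrow> real \<Rightarrow> real \<Rightarrow> real \<Rightarrow> real \<Rightarrow> real \<Rightarrow> real \<Rightarrow> real \<Rightarrow> real \<Rightarrow> real" where
  "next_theta \<eta>0 \<eta>1 \<eta>2 \<gamma>1 \<gamma>2 \<theta>min \<theta> r \<rho> =
     (if \<rho> < \<eta>0 then \<gamma>2 * \<theta>
      else if r < \<eta>1 / \<theta> then \<gamma>2 * \<theta>
      else if r \<le> \<eta>2 / \<theta> then \<theta>
      else max (\<gamma>1 * \<theta>) \<theta>min)"

text \<open>
  A realization of the algorithm that reaches iteration \<open>N\<close>: the iterations before \<open>N\<close> are
  carried out completely, without stopping, and in iteration \<open>N\<close> the Jacobian model is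
  computed. The sample vectors are an arbitrary outcome of the random generation, and the
  values of the sequences beyond this point are irrelevant.
\<close>

definition realization_reaching ::
  "nat \<Rightarrow> real \<Rightarrow> real \<Rightarrow> real \<Rightarrow> real \<Rightarrow> real \<Rightarrow> real \<Rightarrow> real
    \<Rightarrow> (real ^ 'n \<Rightarrow> real ^ 'm) \<Rightarrow> (nat \<Rightarrow> real ^ 'n) \<Rightarrow> (nat \<Rightarrow> real)
    \<Rightarrow> (nat \<Rightarrow> real) \<Rightarrow> (nat \<Rightarrow> real) \<Rightarrow> (nat \<Rightarrow> 'p::finite \<Rightarrow> real ^ 'n)
    \<Rightarrow> (nat \<Rightarrow> real ^ 'n ^ 'm) \<Rightarrow> (nat \<Rightarrow> real ^ 'n) \<Rightarrow> bool" where
  "realization_reaching N \<eta>0 \<eta>1 \<eta>2 \<gamma>1 \<gamma>2 \<theta>min \<epsilon>0 F x \<theta> \<sigma> \<xi> v Jm d \<longleftrightarrow>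
     (\<forall>k\<le>N. model_step F (x k) (\<sigma> k) (\<xi> k) (v k) (Jm k)) \<and>
     (\<forall>k<N.
        \<not> norm (model_gradient F (x k) (Jm k)) \<le> \<epsilon>0 \<and>
        trial_step F (x k) (Jm k) (\<theta> k) (d k) \<and>
        x (Suc k) =
          (if reduction_ratio F (x k) (Jm k) (d k) \<ge> \<eta>0 then x k + d k else x k) \<and>
        \<theta> (Suc k) =
          next_theta \<eta>0 \<eta>1 \<eta>2 \<gamma>1 \<gamma>2 \<theta>min (\<theta> k)
            (norm (model_gradient F (x k) (Jm k)))
            (reduction_ratio F (x k) (Jm k) (d k)))"

definition first_order_accurate ::
  "real \<Rightarrow> (real ^ 'n \<Rightarrow> real ^ 'm) \<Rightarrow> real ^ 'n \<Rightarrow> real \<Rightarrow> real ^ 'n ^ 'm \<Rightarrow> bool" where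
  "first_order_accurate \<kappa> F x \<theta> J \<longleftrightarrow>
     spectral_norm (J - jacobian F (at x)) \<le> \<kappa> / \<theta>"

lemma grad_eqI:
  assumes "GDERIV f x :> D"
  shows "grad f x = D"
proof -
  have "D' = D" if "GDERIV f x :> D'" for D'
  proof -
    have "(\<lambda>h. inner h D') = (\<lambda>h. inner h D)"
      using assms that unfolding gderiv_def by (rule has_derivative_unique[rotated])
    then have "inner (D' - D) D' = inner (D' - D) D" by meson
    then have "inner (D' - D) (D' - D) = 0" by (simp add: inner_diff_right)
    then show ?thesis by simp
  qed
  then show ?thesis unfolding grad_def using assms by blast
qed

lemma rip_const_least:
  fixes A :: "real ^ 'n ^ 'p"
  assumes "0 < q"
  shows "rip_bounds q A (rip_const q A)"
    and "rip_bounds q A \<delta> \<Longrightarrow> rip_const q A \<le> \<delta>"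
proof -
  let ?S = "{\<delta>. rip_bounds q A \<delta>}"
  obtain K where K: "K > 0" "\<And>x. norm (A *v x) \<le> K * norm x"
    using linear_bounded_pos[OF matrix_vector_mul_linear[of A]] by blast
  have "rip_bounds q A (max 1 (K\<^sup>2))"
    unfolding rip_bounds_def
  proof (intro allI impI conjI)
    fix x :: "real ^ 'n"
    have "(1 - max 1 (K\<^sup>2)) * (norm x)\<^sup>2 \<le> 0"
      by (intro mult_nonpos_nonneg) auto
    then show "(1 - max 1 (K\<^sup>2)) * (norm x)\<^sup>2 \<le> (norm (A *v x))\<^sup>2"
      by (rule order_trans) simp
    have "(norm (A *v x))\<^sup>2 \<le> (K * norm x)\<^sup>2"
      using K(2)[of x] by (intro power_mono) auto
    also have "\<dots> \<le> (1 + max 1 (K\<^sup>2)) * (norm x)\<^sup>2"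
      unfolding power_mult_distrib by (intro mult_right_mono) auto
    finally show "(norm (A *v x))\<^sup>2 \<le> (1 + max 1 (K\<^sup>2)) * (norm x)\<^sup>2" .
  qed
  then have ne: "?S \<noteq> {}" by blast
  have closed: "closed ?S"
    unfolding rip_bounds_def
    by (intro closed_Collect_all closed_Collect_imp closed_Collect_conj closed_Collect_le
        continuous_intros) auto
  have nonneg: "0 \<le> \<delta>" if "\<delta> \<in> ?S" for \<delta>
  proof -
    fix i :: 'n
    let ?e = "axis i 1 :: real ^ 'n"
    have "{j. ?e $ j \<noteq> 0} = {i}" by (auto simp: axis_def)
    then have "is_sparse q ?e" using assms by (simp add: is_sparse_def)
    then have "(1 - \<delta>) * (norm ?e)\<^sup>2 \<le> (1 + \<delta>) * (norm ?e)\<^sup>2"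
      using that unfolding rip_bounds_def mem_Collect_eq by (meson order_trans)
    then show ?thesis by simp
  qed
  have bdd: "bdd_below ?S" using nonneg by (rule bdd_belowI)
  have Inf: "Inf ?S \<in> ?S" using closed_contains_Inf[OF ne bdd closed] .
  have least: "rip_const q A = Inf ?S"
    unfolding rip_const_def using Inf cInf_lower[OF _ bdd]
    by (intro Least_equality) auto
  show "rip_bounds q A (rip_const q A)" using Inf least by simp
  show "rip_const q A \<le> \<delta>" if "rip_bounds q A \<delta>"
    unfolding least using that by (intro cInf_lower[OF _ bdd]) simp
qed

end

theory Submission
  imports Defs
begin

text \<open>
  Each gradient is sparse, and the finite differences \<open>\<sigma>\<^sup>-\<^sup>1 y\<close> are noisy linear
  measurements of it: since the gradient is Lipschitz, the first-order Taylor remainder along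
  \<open>\<sigma> v\<^sup>j\<close> is at most \<open>\<kappa>lg \<sigma>\<^sup>2 \<kappa>bv\<^sup>2 / 2\<close>, so the measurement noise, a vector with
  \<open>p\<close> entries, has norm at most \<open>\<xi> = \<surd>p \<kappa>lg \<kappa>bv\<^sup>2 \<sigma> / 2\<close>. Sparse recovery then puts every row
  of the model within \<open>c1 \<xi>\<close> of the corresponding gradient
  (\<open>l1_solution_of_differences_near_gradient\<close>), and passing from rows to the spectral norm
  costs a factor \<open>\<surd>m\<close>. The error is thus proportional to \<open>\<sigma>\<close>.

  It remains to see that \<open>\<sigma>\<close>, the length of the previous step, is at most \<open>\<gamma>2 / \<theta>\<close>. The
  Levenberg-Marquardt step has length at most the ratio of the model gradient norm to the
  damping parameter. As the damping parameter is \<open>\<theta>\<close> times that same norm, this ratio is the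
  reciprocal of the previous \<open>\<theta>\<close> (\<open>trial_step_norm_le\<close>), and one update increases \<open>\<theta>\<close> at
  most by the factor \<open>\<gamma>2\<close> (\<open>next_theta_le\<close>).
\<close>

section \<open>Entrywise and row bounds for norms\<close>

text \<open>
  This comparison of norms is used twice: for the noise vector, whose entries are Taylor
  remainders, and for the product of the model error with a vector.
\<close>

lemma norm_le_sqrt_card_times_entry_bound:
  fixes w :: "real ^ 'm"
  assumes "\<And>i. \<bar>w $ i\<bar> \<le> B"
  shows "norm w \<le> sqrt (real CARD('m)) * B"
proof -
  have B: "0 \<le> B" using assms[of undefined] by linarith
  have "norm w \<le> sqrt (\<Sum>i\<in>(UNIV::'m set). B\<^sup>2)"
    unfolding norm_vec_def L2_set_def
    by (intro real_sqrt_le_mono sum_mono power_mono) (use assms in auto)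
  also have "\<dots> = sqrt (real CARD('m)) * B"
    using B by (simp add: real_sqrt_mult)
  finally show ?thesis .
qed

lemma spectral_norm_le_sqrt_card_times_row_bound:
  fixes A :: "real ^ 'n ^ 'm"
  assumes "\<And>i. norm (row i A) \<le> B"
  shows "spectral_norm A \<le> sqrt (real CARD('m)) * B"
  unfolding spectral_norm_def
proof (rule onorm_le)
  fix x :: "real ^ 'n"
  have "\<bar>(A *v x) $ i\<bar> \<le> B * norm x" for i
  proof -
    have "\<bar>(A *v x) $ i\<bar> = \<bar>row i A \<bullet> x\<bar>"
      by (simp add: matrix_vector_mult_def row_def inner_vec_def)
    also have "\<dots> \<le> norm (row i A) * norm x" by (rule Cauchy_Schwarz_ineq2)
    also have "\<dots> \<le> B * norm x" by (intro mult_right_mono assms) simp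
    finally show ?thesis .
  qed
  from norm_le_sqrt_card_times_entry_bound[OF this]
  show "norm (A *v x) \<le> sqrt (real CARD('m)) * B * norm x" by (simp add: mult.assoc)
qed

section \<open>Gradients and Taylor remainders\<close>

lemma component_GDERIV_row_jacobian:
  fixes F :: "real ^ 'n \<Rightarrow> real ^ 'm"
  assumes "F differentiable (at x)"
  shows "GDERIV (\<lambda>u. F u $ i) x :> row i (jacobian F (at x))"
proof -
  have "(F has_derivative (\<lambda>h. jacobian F (at x) *v h)) (at x)"
    using assms jacobian_works by blast
  then have "((\<lambda>u. F u $ i) has_derivative (\<lambda>h. (jacobian F (at x) *v h) $ i)) (at x)"
    by (rule bounded_linear.has_derivative[OF bounded_linear_vec_nth])
  moreover have "(\<lambda>h. (jacobian F (at x) *v h) $ i) = (\<lambda>h. h \<bullet> row i (jacobian F (at x)))"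
    by (simp add: fun_eq_iff matrix_vector_mult_def row_def inner_vec_def mult.commute)
  ultimately show ?thesis unfolding gderiv_def by simp
qed

text \<open>
  The upper half of the quadratic Taylor bound: along the segment, the remainder minus
  \<open>L \<parallel>h\<parallel>\<^sup>2 t\<^sup>2 / 2\<close> has nonpositive derivative, by Cauchy-Schwarz and the Lipschitz condition.
\<close>

lemma taylor_upper_bound_lipschitz_gradient:
  fixes f :: "'a::real_inner \<Rightarrow> real"
  assumes deriv: "\<And>y. GDERIV f y :> G y"
    and lip: "\<And>y z. norm (G y - G z) \<le> L * norm (y - z)"
  shows "f (x + h) - f x - h \<bullet> G x \<le> L / 2 * (norm h)\<^sup>2"
proof -
  define \<psi> where "\<psi> t = f (x + t *\<^sub>R h) - t * (h \<bullet> G x) - L / 2 * (norm h)\<^sup>2 * t\<^sup>2" for t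
  have line: "((\<lambda>t. f (x + t *\<^sub>R h)) has_real_derivative h \<bullet> G (x + t *\<^sub>R h)) (at t)" for t
  proof -
    have "((\<lambda>t. x + t *\<^sub>R h) has_derivative (\<lambda>t. t *\<^sub>R h)) (at t)"
      by (auto intro!: derivative_eq_intros)
    from has_derivative_compose[OF this deriv[unfolded gderiv_def]]
    show ?thesis by (simp add: has_field_derivative_def mult.commute[of _ "h \<bullet> _"])
  qed
  have "\<psi> 1 \<le> \<psi> 0"
  proof (rule DERIV_nonpos_imp_nonincreasing[where f = \<psi>])
    fix t :: real
    assume t: "0 \<le> t"
    have "(\<psi> has_real_derivative
        h \<bullet> G (x + t *\<^sub>R h) - h \<bullet> G x - L * (norm h)\<^sup>2 * t) (at t)"
      unfolding \<psi>_def by (auto intro!: derivative_eq_intros line)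
    moreover have "h \<bullet> G (x + t *\<^sub>R h) - h \<bullet> G x \<le> L * (norm h)\<^sup>2 * t"
    proof -
      have "h \<bullet> G (x + t *\<^sub>R h) - h \<bullet> G x \<le> norm h * norm (G (x + t *\<^sub>R h) - G x)"
        using norm_cauchy_schwarz by (simp flip: inner_diff_right)
      also have "\<dots> \<le> norm h * (L * norm (t *\<^sub>R h))"
        using lip[of "x + t *\<^sub>R h" x] by (intro mult_left_mono) simp_all
      also have "\<dots> = L * (norm h)\<^sup>2 * t" using t by (simp add: power2_eq_square)
      finally show ?thesis .
    qed
    ultimately show "\<exists>y. (\<psi> has_real_derivative y) (at t) \<and> y \<le> 0"
      by (intro exI[of _ "h \<bullet> G (x + t *\<^sub>R h) - h \<bullet> G x - L * (norm h)\<^sup>2 * t"]) simp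
  qed simp
  then show ?thesis by (simp add: \<psi>_def)
qed

lemma taylor_bound_lipschitz_gradient:
  fixes f :: "'a::real_inner \<Rightarrow> real"
  assumes deriv: "\<And>y. GDERIV f y :> G y"
    and lip: "\<And>y z. norm (G y - G z) \<le> L * norm (y - z)"
  shows "\<bar>f (x + h) - f x - h \<bullet> G x\<bar> \<le> L / 2 * (norm h)\<^sup>2"
proof -
  have "- f (x + h) - - f x - h \<bullet> - G x \<le> L / 2 * (norm h)\<^sup>2"
  proof (rule taylor_upper_bound_lipschitz_gradient)
    show "GDERIV (\<lambda>y. - f y) y :> - G y" for y using deriv by (rule GDERIV_minus)
    show "norm (- G y - - G z) \<le> L * norm (y - z)" for y z
      using lip[of y z] by (simp add: norm_minus_commute)
  qed
  then have "- (f (x + h) - f x - h \<bullet> G x) \<le> L / 2 * (norm h)\<^sup>2"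
    by (simp add: algebra_simps)
  with taylor_upper_bound_lipschitz_gradient[OF assms, of x h] show ?thesis by (rule abs_leI)
qed

section \<open>Sparse recovery of a gradient\<close>

text \<open>
  Dividing the Taylor remainders by \<open>\<sigma>\<close> leaves one factor \<open>\<sigma>\<close> in the noise of the scaled
  differences, which are therefore measurements of the gradient within the tolerance of the
  \<open>\<ell>\<^sub>1\<close> problem.
\<close>

lemma scaled_differences_near_gradient_measurements:
  fixes f :: "real ^ 'n \<Rightarrow> real" and v :: "'p::finite \<Rightarrow> real ^ 'n"
  assumes deriv: "\<And>y. GDERIV f y :> G y"
    and lip: "\<And>y z. norm (G y - G z) \<le> L * norm (y - z)"
    and L: "0 \<le> L" and \<sigma>: "0 < \<sigma>" and v: "\<And>j. norm (v j) \<le> \<kappa>"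
  shows "norm (inverse \<sigma> *\<^sub>R sample_diff f x \<sigma> v - sample_matrix v *v G x)
           \<le> sqrt (real CARD('p)) * L * \<kappa>\<^sup>2 * \<sigma> / 2"
proof -
  let ?z = "inverse \<sigma> *\<^sub>R sample_diff f x \<sigma> v - sample_matrix v *v G x"
  have "\<bar>?z $ j\<bar> \<le> L * \<kappa>\<^sup>2 * \<sigma> / 2" for j
  proof -
    let ?r = "f (x + \<sigma> *\<^sub>R v j) - f x - (\<sigma> *\<^sub>R v j) \<bullet> G x"
    have "(sample_matrix v *v G x) $ j = v j \<bullet> G x"
      by (simp add: sample_matrix_def matrix_vector_mult_def inner_vec_def)
    then have "?z $ j = ?r / \<sigma>"
      using \<sigma> by (simp add: sample_diff_def field_simps)
    then have "\<bar>?z $ j\<bar> = \<bar>?r\<bar> / \<sigma>" using \<sigma> by simp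
    also have "\<dots> \<le> L / 2 * (norm (\<sigma> *\<^sub>R v j))\<^sup>2 / \<sigma>"
      using \<sigma> by (intro divide_right_mono taylor_bound_lipschitz_gradient[OF deriv lip]) simp
    also have "\<dots> = L * (norm (v j))\<^sup>2 * \<sigma> / 2"
      using \<sigma> by (simp add: power_mult_distrib power2_eq_square)
    also have "\<dots> \<le> L * \<kappa>\<^sup>2 * \<sigma> / 2"
      using \<sigma> L v[of j]
      by (intro divide_right_mono mult_right_mono mult_left_mono power_mono) simp_all
    finally show ?thesis .
  qed
  from norm_le_sqrt_card_times_entry_bound[OF this] show ?thesis by (simp add: mult.assoc)
qed

lemma l1_solution_of_differences_near_gradient:
  fixes f :: "real ^ 'n \<Rightarrow> real" and v :: "'p::finite \<Rightarrow> real ^ 'n"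
  assumes recovery: "recovery_const TYPE(real ^ 'n ^ 'p) s c"
    and rip: "rip_matrix s (sample_matrix v)"
    and deriv: "\<And>y. GDERIV f y :> G y"
    and lip: "\<And>y z. norm (G y - G z) \<le> L * norm (y - z)"
    and L: "0 \<le> L" and sparse: "is_sparse s (G x)"
    and \<sigma>: "0 < \<sigma>" and v: "\<And>j. norm (v j) \<le> \<kappa>"
    and \<xi>: "\<xi> = sqrt (real CARD('p)) * L * \<kappa>\<^sup>2 * \<sigma> / 2"
    and g: "l1_solution (sample_matrix v) (inverse \<sigma> *\<^sub>R sample_diff f x \<sigma> v) \<xi> g"
  shows "norm (g - G x) \<le> c (rip_const (2 * s) (sample_matrix v)) * \<xi>"
proof -
  let ?z = "inverse \<sigma> *\<^sub>R sample_diff f x \<sigma> v - sample_matrix v *v G x"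
  have "norm ?z \<le> \<xi>"
    unfolding \<xi> by (rule scaled_differences_near_gradient_measurements[OF deriv lip L \<sigma> v])
  moreover have "l1_solution (sample_matrix v) (sample_matrix v *v G x + ?z) \<xi> g"
    using g by simp
  ultimately show ?thesis
    using recovery rip sparse unfolding recovery_const_def rip_matrix_def by blast
qed

section \<open>Step length and the regularization parameter\<close>

text \<open>
  Testing the Levenberg-Marquardt equation against \<open>d\<close> itself, the Gauss-Newton part contributes
  \<open>\<parallel>J d\<parallel>\<^sup>2 \<ge> 0\<close>. What remains is \<open>\<theta> \<parallel>g\<parallel> \<parallel>d\<parallel>\<^sup>2 \<le> \<parallel>g\<parallel> \<parallel>d\<parallel>\<close>, with \<open>g\<close> the model gradient.
\<close>

lemma trial_step_norm_le:
  assumes step: "trial_step F x J \<theta> d" and \<theta>: "0 < \<theta>"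
    and g: "model_gradient F x J \<noteq> 0"
  shows "norm d \<le> 1 / \<theta>"
proof (cases "d = 0")
  case True
  then show ?thesis using \<theta> by simp
next
  case False
  let ?g = "model_gradient F x J"
  let ?damping = "\<theta> * norm ?g"
  have "transpose J *v (J *v d) + ?damping *\<^sub>R d = - ?g"
    using step unfolding trial_step_def
    by (simp add: matrix_vector_mult_add_rdistrib matrix_vector_mul_assoc
        flip: scaleR_matrix_vector_assoc)
  then have "d \<bullet> (transpose J *v (J *v d)) + ?damping * (norm d)\<^sup>2 = - (d \<bullet> ?g)"
    by (metis inner_add_right inner_minus_right inner_scaleR_right power2_norm_eq_inner)
  moreover have "d \<bullet> (transpose J *v (J *v d)) = (norm (J *v d))\<^sup>2"
    by (simp add: dot_lmul_matrix power2_norm_eq_inner inner_commute[of d])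
  moreover have "- (d \<bullet> ?g) \<le> norm d * norm ?g"
    using Cauchy_Schwarz_ineq2[of d ?g] by linarith
  moreover have "0 \<le> (norm (J *v d))\<^sup>2" by simp
  ultimately have "?damping * (norm d)\<^sup>2 \<le> norm d * norm ?g" by linarith
  then have "(\<theta> * norm d) * (norm d * norm ?g) \<le> 1 * (norm d * norm ?g)"
    by (simp add: power2_eq_square mult_ac)
  then have "\<theta> * norm d \<le> 1"
    using False g by (subst (asm) mult_le_cancel_right_pos) auto
  then show ?thesis using \<theta> by (simp add: field_simps)
qed

text \<open>
  The lower bound on \<open>\<theta>\<close> is essential: when the update resets \<open>\<theta>\<close> to \<open>\<theta>min\<close>, the growth factor
  is controlled only because \<open>\<theta>\<close> was at least \<open>\<theta>min\<close> before.
\<close>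

lemma next_theta_le:
  assumes "0 < \<theta>min" "\<theta>min \<le> \<theta>" "\<gamma>1 < 1" "1 < \<gamma>2"
  shows "next_theta \<eta>0 \<eta>1 \<eta>2 \<gamma>1 \<gamma>2 \<theta>min \<theta> r \<rho> \<le> \<gamma>2 * \<theta>"
proof -
  have "\<theta> \<le> \<gamma>2 * \<theta>" "\<gamma>1 * \<theta> \<le> \<theta>" using assms by simp_all
  then show ?thesis using assms unfolding next_theta_def max_def by (smt (verit))
qed

lemma next_theta_ge_theta_min:
  assumes "0 < \<theta>min" "\<theta>min \<le> \<theta>" "1 < \<gamma>2"
  shows "\<theta>min \<le> next_theta \<eta>0 \<eta>1 \<eta>2 \<gamma>1 \<gamma>2 \<theta>min \<theta> r \<rho>"
proof -
  have "\<theta> \<le> \<gamma>2 * \<theta>" using assms by simp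
  then show ?thesis using assms unfolding next_theta_def max_def by (smt (verit))
qed

lemma realization_theta_ge_theta_min:
  assumes run: "realization_reaching N \<eta>0 \<eta>1 \<eta>2 \<gamma>1 \<gamma>2 \<theta>min \<epsilon>0 F x \<theta> \<sigma> \<xi> v Jm d"
    and "0 < \<theta>min" "\<theta>min \<le> \<theta> 0" "1 < \<gamma>2" "k \<le> N"
  shows "\<theta>min \<le> \<theta> k"
  using \<open>k \<le> N\<close>
proof (induction k)
  case 0
  show ?case by fact
next
  case (Suc k)
  then have "\<theta>min \<le> \<theta> k" by simp
  with Suc.prems run assms(2,4) show ?case
    unfolding realization_reaching_def by (simp add: next_theta_ge_theta_min)
qed

text \<open>
  First-order accuracy at an iterate refers to the updated \<open>\<theta>\<close>, whereas the step was computed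
  with the previous one; exchanging the two costs the factor \<open>\<gamma>2\<close>.
\<close>

lemma realization_step_norm_le:
  assumes run: "realization_reaching N \<eta>0 \<eta>1 \<eta>2 \<gamma>1 \<gamma>2 \<theta>min \<epsilon>0 F x \<theta> \<sigma> \<xi> v Jm d"
    and \<theta>: "0 < \<theta>min" "\<theta>min \<le> \<theta> 0" and \<gamma>: "\<gamma>1 < 1" "1 < \<gamma>2"
    and "0 < \<epsilon>0" "k < N"
  shows "norm (d k) \<le> \<gamma>2 / \<theta> (Suc k)"
proof -
  have ge: "\<theta>min \<le> \<theta> k" "\<theta>min \<le> \<theta> (Suc k)"
    using realization_theta_ge_theta_min[OF run \<theta> \<gamma>(2)] \<open>k < N\<close> by simp_all
  then have pos: "0 < \<theta> k" "0 < \<theta> (Suc k)" using \<theta>(1) by linarith+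
  have "trial_step F (x k) (Jm k) (\<theta> k) (d k)"
    and active: "\<not> norm (model_gradient F (x k) (Jm k)) \<le> \<epsilon>0"
    using run \<open>k < N\<close> unfolding realization_reaching_def by blast+
  moreover have "model_gradient F (x k) (Jm k) \<noteq> 0"
    using active \<open>0 < \<epsilon>0\<close> by auto
  ultimately have "norm (d k) \<le> 1 / \<theta> k"
    using pos(1) by (intro trial_step_norm_le) auto
  also have "\<theta> (Suc k) \<le> \<gamma>2 * \<theta> k"
    using run \<open>k < N\<close> ge \<theta>(1) \<gamma>
    unfolding realization_reaching_def by (simp add: next_theta_le)
  then have "1 / \<theta> k \<le> \<gamma>2 / \<theta> (Suc k)"
    using pos by (simp add: field_simps)
  finally show ?thesis .
qed

section \<open>Accuracy of the Jacobian model\<close>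

theorem theorem3p6:
  fixes F :: "real ^ 'n \<Rightarrow> real ^ 'm"
    and s k :: nat
    and \<eta>0 \<eta>1 \<eta>2 \<gamma>1 \<gamma>2 \<theta>min \<epsilon>0 \<kappa>lg \<kappa>bv \<kappa>ej :: real
    and c1 :: "real \<Rightarrow> real"
    and \<theta> \<sigma> \<xi> :: "nat \<Rightarrow> real"
    and x d :: "nat \<Rightarrow> real ^ 'n"
    and v :: "nat \<Rightarrow> 'p::finite \<Rightarrow> real ^ 'n"
    and Jm :: "nat \<Rightarrow> real ^ 'n ^ 'm"
  assumes "CARD('p) < CARD('n)" and "1 \<le> s"
    and "continuously_differentiable F"
    and "0 < \<kappa>lg"
    and "\<And>i y z. norm (grad (\<lambda>u. F u $ i) y - grad (\<lambda>u. F u $ i) z) \<le> \<kappa>lg * norm (y - z)"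
    and "\<And>i y. is_sparse s (grad (\<lambda>u. F u $ i) y)"
    and "recovery_const TYPE(real ^ 'n ^ 'p) s c1"
    and "0 < \<eta>0" "\<eta>0 < 1" "0 < \<eta>1" "\<eta>1 < \<eta>2" "0 < \<gamma>1" "\<gamma>1 < 1" "1 < \<gamma>2"
    and "0 < \<theta>min" "\<theta>min \<le> \<theta> 0" "0 < \<epsilon>0"
    and "0 < \<kappa>bv"
    and "1 \<le> k"
    and "realization_reaching k \<eta>0 \<eta>1 \<eta>2 \<gamma>1 \<gamma>2 \<theta>min \<epsilon>0 F x \<theta> \<sigma> \<xi> v Jm d"
    and "\<And>l. 1 \<le> l \<Longrightarrow> l \<le> k \<Longrightarrow> \<sigma> l = norm (d (l - 1))"
    and "\<And>l. 1 \<le> l \<Longrightarrow> l \<le> k \<Longrightarrow> \<xi> l = sqrt (real CARD('p)) * \<kappa>lg * \<kappa>bv\<^sup>2 * \<sigma> l / 2"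
    and "rip_matrix s (sample_matrix (v k))"
    and "\<And>j. norm (v k j) \<le> \<kappa>bv"
    and "\<kappa>ej = sqrt (real CARD('m) * real CARD('p))
                 * c1 (rip_const (2 * s) (sample_matrix (v k))) * \<gamma>2 * \<kappa>lg * \<kappa>bv\<^sup>2 / 2"
  shows "first_order_accurate \<kappa>ej F (x k) (\<theta> k) (Jm k)"
proof -
  note diff = assms(3) and lg = assms(4) and lip = assms(5) and sparse = assms(6)
    and run = assms(20) and \<kappa>ej = assms(25)
  let ?c = "c1 (rip_const (2 * s) (sample_matrix (v k)))"
  let ?J = "jacobian F (at (x k))"
  have step: "model_step F (x k) (\<sigma> k) (\<xi> k) (v k) (Jm k)"
    using run unfolding realization_reaching_def by blast
  then have pos: "0 < \<sigma> k" "0 < \<xi> k" unfolding model_step_def by auto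
  have \<xi>: "\<xi> k = sqrt (real CARD('p)) * \<kappa>lg * \<kappa>bv\<^sup>2 * \<sigma> k / 2"
    using assms(19,22) by blast
  have row_error: "norm (row i (Jm k - ?J)) \<le> ?c * \<xi> k" for i
  proof -
    have deriv: "GDERIV (\<lambda>u. F u $ i) y :> row i (jacobian F (at y))" for y
      using diff unfolding continuously_differentiable_def
      by (intro component_GDERIV_row_jacobian) blast
    then have grad: "grad (\<lambda>u. F u $ i) y = row i (jacobian F (at y))" for y
      by (rule grad_eqI)
    have "norm (row i (Jm k) - row i ?J) \<le> ?c * \<xi> k"
    proof (rule l1_solution_of_differences_near_gradient[where G = "\<lambda>y. row i (jacobian F (at y))"])
      show "recovery_const TYPE(real ^ 'n ^ 'p) s c1" by fact
      show "norm (row i (jacobian F (at y)) - row i (jacobian F (at z))) \<le> \<kappa>lg * norm (y - z)"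
        for y z using lip[of i y z] by (simp only: grad)
      show "is_sparse s (row i ?J)" using sparse[of i "x k"] by (simp only: grad)
      show "l1_solution (sample_matrix (v k))
          (inverse (\<sigma> k) *\<^sub>R sample_diff (\<lambda>u. F u $ i) (x k) (\<sigma> k) (v k)) (\<xi> k) (row i (Jm k))"
        using step unfolding model_step_def by blast
    qed (use deriv lg pos \<xi> assms(23,24) in auto)
    then show ?thesis by (simp add: row_def vec_eq_iff minus_vec_def)
  qed
  \<comment> \<open>Nothing is assumed about the sign of \<open>c1\<close>, but a negative value would bound a norm by a
    negative number, the tolerance being positive. The sign is needed to enlarge \<open>\<sigma> k\<close> below.\<close>
  have c: "0 \<le> ?c"
  proof -
    have "0 \<le> ?c * \<xi> k" using norm_ge_zero row_error by (rule order_trans)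
    then show ?thesis using pos by (simp add: zero_le_mult_iff)
  qed
  obtain l where l: "k = Suc l" using assms(19) by (cases k) auto
  have "\<sigma> k = norm (d l)" using assms(19) assms(21)[of k] l by simp
  also have "\<dots> \<le> \<gamma>2 / \<theta> k"
    unfolding l
    by (rule realization_step_norm_le[OF run assms(15,16,13,14,17)]) (simp add: l)
  finally have \<sigma>: "\<sigma> k \<le> \<gamma>2 / \<theta> k" .
  have "spectral_norm (Jm k - ?J) \<le> sqrt (real CARD('m)) * (?c * \<xi> k)"
    using row_error by (rule spectral_norm_le_sqrt_card_times_row_bound)
  also have "\<dots> = sqrt (real CARD('m) * real CARD('p)) * ?c * \<kappa>lg * \<kappa>bv\<^sup>2 / 2 * \<sigma> k"
    by (simp add: \<xi> real_sqrt_mult)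
  also have "\<dots> \<le> sqrt (real CARD('m) * real CARD('p)) * ?c * \<kappa>lg * \<kappa>bv\<^sup>2 / 2 * (\<gamma>2 / \<theta> k)"
    using c lg \<sigma> by (intro mult_left_mono) simp_all
  also have "\<dots> = \<kappa>ej / \<theta> k" by (simp add: \<kappa>ej)
  finally show ?thesis unfolding first_order_accurate_def .
qed

end
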